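(* Fix a beam $k$ and a user $n\in\{1,\dots,N\}$. Let $Z=Z_n^{(k)}$ be a shadowed-Rician power gain with parameters $(m,b,\Omega)=(m_n^{(k)},b_n^{(k)},\Omega_n^{(k)})$, where $m$ is a positive integer and $b,\Omega>0$, and let $\alpha,\beta,\delta$ be the associated constants. Let $P=P^{(k)}>0$, $L=L_n^{(k)}>0$, $N_0>0$, $\rho=P/N_0$, let $\zeta_c,\zeta_1,\dots,\zeta_N\ge 0$ satisfy $\zeta_c+\sum_{j=1}^N\zeta_j=1$, and let $\gamma_c^{th}=2^{R_c}-1$, $\gamma_p^{th}=2^{R_p}-1$ with target rates $R_c,R_p>0$. Define the SINRs $$\gamma_{c,n}=\frac{P\zeta_c Z L}{P(1-\zeta_c)ZL+N_0},\qquad \gamma_{p,n}=\frac{P\zeta_n Z L}{\sum_{j\ne n}\zeta_j P Z L+N_0},$$ and the outage probability $P_{\mathrm{out},n}=1-\Pr\left(\gamma_{c,n}\ge\gamma_c^{th}\text{ and }\gamma_{p,n}\ge\gamma_p^{th}\right)$. Set $$A_1=\beta-\delta,\quad A_2=\rho L\left(\zeta_c-\gamma_c^{th}(1-\zeta_c)\right),\quad A_3=\rho L\Big(\zeta_n-\gamma_p^{th}\sum_{j\ne n}\zeta_j\Big).$$ Then $$P_{\mathrm{out},n}=\max\left(\mathcal P_{c},\mathcal P_{p}\right),$$ where $$\mathcal P_{c}=1-\sum_{i=0}^{m-1}\sum_{l=0}^{i}\binom{m-1}{i}\frac{\alpha\,\delta^i}{l!}\exp\left(-\frac{A_1\gamma_c^{th}}{A_2}\right)\frac{(\gamma_c^{th}/A_2)^l}{A_1^{\,i-l+1}}\quad\text{if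 }A_2>0,\qquad \mathcal P_c=1\text{ otherwise},$$ $$\mathcal P_{p}=1-\sum_{i=0}^{m-1}\sum_{l=0}^{i}\binom{m-1}{i}\frac{\alpha\,\delta^i}{l!}\exp\left(-\frac{A_1\gamma_p^{th}}{A_3}\right)\frac{(\gamma_p^{th}/A_3)^l}{A_1^{\,i-l+1}}\quad\text{if }A_3>0,\qquad \mathcal P_p=1\text{ otherwise}.$$
   Context: Shadowed-Rician power gain: for a positive integer $m$ and reals $b,\Omega>0$, a nonnegative random variable $Z$ is a shadowed-Rician power gain with parameters $(m,b,\Omega)$ if it has density $$f_Z(z)=\alpha e^{-\beta z}\,{}_1F_1(m;1;\delta z),\quad z\ge0,$$ where ${}_1F_1$ is the confluent hypergeometric function of the first kind and $$\alpha=\frac1{2b}\left(\frac{2bm}{2bm+\Omega}\right)^m,\quad \beta=\frac1{2b},\quad \delta=\frac{\Omega}{2b(2bm+\Omega)}.$$ Setting: downlink rate-splitting multiple access with orthogonal frequency allocation across beams (no inter-beam interference). $P$ is the beam transmit power, $L$ the deterministic large-scale gain, $N_0$ the noise power, $\zeta_c$ the power fraction of the common stream and $\zeta_j$ that of user $j$'s private stream. $\gamma_{c,n}$ is the SINR of user $n$ for the common stream and $\gamma_{p,n}$ its SINR for its private stream after cancellation of the common stream. The user is in outage unless both SINRs reach their thresholds. *)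

theory Defs
  imports "HOL-Analysis.Analysis" "HOL-Probability.Probability"
begin

definition hypergeo_1F1 :: "real \<Rightarrow> real \<Rightarrow> real \<Rightarrow> real" where
  "hypergeo_1F1 a c x = eval_fps (fps_hypergeo [a] [c] 1) x"

lemma hypergeo_1F1_series:
  "hypergeo_1F1 a c x = (\<Sum>n. pochhammer a n / pochhammer c n * x ^ n / fact n)"
  by (simp add: hypergeo_1F1_def eval_fps_def field_simps)

definition sr_alpha :: "nat \<Rightarrow> real \<Rightarrow> real \<Rightarrow> real" where
  "sr_alpha m b \<Omega> = 1 / (2 * b) * (2 * b * real m / (2 * b * real m + \<Omega>)) ^ m"

definition sr_beta :: "real \<Rightarrow> real" where
  "sr_beta b = 1 / (2 * b)"

definition sr_delta :: "nat \<Rightarrow> real \<Rightarrow> real \<Rightarrow> real" where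
  "sr_delta m b \<Omega> = \<Omega> / (2 * b * (2 * b * real m + \<Omega>))"

definition sr_density :: "nat \<Rightarrow> real \<Rightarrow> real \<Rightarrow> real \<Rightarrow> real" where
  "sr_density m b \<Omega> z =
     (if 0 \<le> z
      then sr_alpha m b \<Omega> * exp (- sr_beta b * z) * hypergeo_1F1 (real m) 1 (sr_delta m b \<Omega> * z)
      else 0)"

(* Nonnegativity is only required almost surely; for m \<ge> 1 and b, \<Omega> > 0 it already follows
   from the density, which vanishes on the negative half-line.  In that range sr_density is
   nonnegative, so the coercion to ennreal loses nothing. *)
definition shadowed_rician_power_gain ::
    "'a measure \<Rightarrow> nat \<Rightarrow> real \<Rightarrow> real \<Rightarrow> ('a \<Rightarrow> real) \<Rightarrow> bool" where
  "shadowed_rician_power_gain M m b \<Omega> Z \<longleftrightarrow>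
     (AE \<omega> in M. 0 \<le> Z \<omega>) \<and>
     distributed M lborel Z (\<lambda>z. ennreal (sr_density m b \<Omega> z))"

end

theory Submission
  imports Defs
begin

text \<open>
  For a positive integer \<open>m\<close>, Kummer's transformation turns \<open>\<^sub>1F\<^sub>1(m; 1; \<delta>z)\<close> into \<open>exp (\<delta>z)\<close> times a
  polynomial, so the density is a finite combination of the functions \<open>z ^ i * exp (- A\<^sub>1 z)\<close> and its
  tail integrals have a closed form.  Each SINR is nondecreasing in the gain, so each threshold
  condition says that the gain exceeds a level, or never holds when the corresponding coefficient
  is nonpositive.  Both conditions are driven by the same gain, so their intersection is the smaller
  of the two tail events; this is where the maximum comes from.
\<close>

text \<open>The rising factorial \<open>(k+1)...(k+n)\<close> is \<open>(k+n)! / k!\<close>, shown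
  in product form by induction. Through it the Taylor coefficients of the hypergeometric series
  become binomials over factorials.\<close>

lemma pochhammer_of_nat_Suc:
  "pochhammer (real (Suc k)) n = fact n * real ((k + n) choose n)"
proof -
  have "fact k * pochhammer (real (Suc k)) n = fact (k + n)"
  proof (induction n)
    case (Suc n)
    have "fact k * pochhammer (real (Suc k)) (Suc n) =
        (real (Suc k) + real n) * (fact k * pochhammer (real (Suc k)) n)"
      by (simp only: pochhammer_rec' mult_ac)
    also have "\<dots> = fact (k + Suc n)"
      unfolding Suc.IH by (simp add: algebra_simps)
    finally show ?case .
  qed simp
  also have "\<dots> = fact k * (fact n * real ((k + n) choose n))"
    by (subst binomial_fact) auto
  finally show ?thesis by (simp only: mult_cancel_left fact_nonzero simp_thms)
qed

text \<open>Vandermonde's convolution after the reflection of \<open>n choose i\<close> to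
  \<open>n choose (n - i)\<close>.\<close>

lemma sum_choose_mult_choose:
  fixes k n :: nat
  shows "(\<Sum>i\<le>n. (k choose i) * (n choose i)) = (k + n) choose n"
proof -
  have "(\<Sum>i\<le>n. (k choose i) * (n choose i)) = (\<Sum>i\<le>n. (k choose i) * (n choose (n - i)))"
    by (intro sum.cong refl) (simp add: binomial_symmetric[symmetric])
  then show ?thesis by (simp add: vandermonde)
qed

text \<open>Kummer's transformation, obtained by multiplying the polynomial with the exponential
  series as a Cauchy product and comparing coefficients of \<open>x ^ n\<close>.\<close>

lemma hypergeo_1F1_Suc:
  "hypergeo_1F1 (real (Suc k)) 1 x = exp x * (\<Sum>i=0..k. real (k choose i) * (x ^ i / fact i))"
proof -
  let ?a = "\<lambda>i. real (k choose i) * (x ^ i / fact i)"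
  let ?e = "\<lambda>j. x ^ j / fact j"
  \<comment> \<open>The polynomial counts as a power series, since \<open>k choose i\<close>
    vanishes for \<open>i > k\<close>.\<close>
  have "summable (\<lambda>i. norm (?a i))"
    by (rule summable_finite[of "{0..k}"]) auto
  moreover have "summable (\<lambda>j. norm (?e j))"
    using summable_norm_exp[of x] by (simp add: divide_inverse mult.commute)
  ultimately have "(\<lambda>n. \<Sum>i\<le>n. ?a i * ?e (n - i)) sums ((\<Sum>i. ?a i) * (\<Sum>j. ?e j))"
    by (rule Cauchy_product_sums)
  moreover have "(\<Sum>i. ?a i) = (\<Sum>i=0..k. ?a i)"
    by (rule suminf_finite) auto
  moreover have "(\<Sum>j. ?e j) = exp x"
    by (simp add: exp_def divide_inverse mult.commute)
  moreover have "(\<Sum>i\<le>n. ?a i * ?e (n - i)) =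
      pochhammer (real (Suc k)) n / pochhammer 1 n * x ^ n / fact n" for n
  proof -
    \<comment> \<open>Here \<open>1 / (i! (n-i)!)\<close> is rewritten as
      \<open>(n choose i) / n!\<close>.\<close>
    have "(\<Sum>i\<le>n. ?a i * ?e (n - i)) =
        (\<Sum>i\<le>n. real ((k choose i) * (n choose i)) * (x ^ n / fact n))"
      by (intro sum.cong refl) (simp add: binomial_fact power_add[symmetric] field_simps)
    also have "\<dots> = real ((k + n) choose n) * (x ^ n / fact n)"
      by (simp only: sum_distrib_right[symmetric] of_nat_sum[symmetric] sum_choose_mult_choose)
    finally show ?thesis
      by (simp add: pochhammer_of_nat_Suc pochhammer_fact[symmetric] del: of_nat_Suc)
  qed
  ultimately show ?thesis
    unfolding hypergeo_1F1_series by (simp add: sums_iff mult.commute)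
qed

text \<open>The antiderivative that repeated integration by parts produces. For \<open>A > 0\<close>
  it is minus the integral of \<open>exp (- A t) * t ^ i / i!\<close> from \<open>z\<close> to
  infinity, an upper incomplete gamma function.\<close>

lemma DERIV_incomplete_gamma:
  fixes A z :: real
  assumes "A \<noteq> 0"
  shows "((\<lambda>z. - (exp (- (A * z)) * (\<Sum>l=0..i. z ^ l / fact l / A ^ (i - l + 1))))
           has_real_derivative exp (- (A * z)) * (z ^ i / fact i)) (at z)"
proof (induction i)
  case 0
  show ?case using assms by (auto intro!: derivative_eq_intros)
next
  case (Suc i)
  let ?G = "\<lambda>i z. - (exp (- (A * z)) * (\<Sum>l=0..i. z ^ l / fact l / A ^ (i - l + 1)))"
  \<comment> \<open>The recurrence of one integration by parts: the summand \<open>l = Suc i\<close>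
    splits off, and each other summand gains a factor \<open>1 / A\<close>.\<close>
  have "?G (Suc i) = (\<lambda>z. ?G i z / A - exp (- (A * z)) * (z ^ Suc i / fact (Suc i) / A))"
  proof
    fix z
    have "(\<Sum>l=0..i. z ^ l / fact l / A ^ (Suc i - l + 1)) =
        (\<Sum>l=0..i. z ^ l / fact l / A ^ (i - l + 1)) / A"
      unfolding sum_divide_distrib by (intro sum.cong refl) (simp add: Suc_diff_le)
    then show "?G (Suc i) z = ?G i z / A - exp (- (A * z)) * (z ^ Suc i / fact (Suc i) / A)"
      by (simp add: algebra_simps)
  qed
  moreover have "((\<lambda>z. ?G i z / A - exp (- (A * z)) * (z ^ Suc i / fact (Suc i) / A))
      has_real_derivative exp (- (A * z)) * (z ^ Suc i / fact (Suc i))) (at z)"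
  proof -
    have power: "((\<lambda>z. z ^ Suc i / fact (Suc i)) has_real_derivative z ^ i / fact i) (at z)"
      by (rule DERIV_cong[OF DERIV_cdivide[OF DERIV_pow]]) (simp add: divide_simps)
    have exp: "((\<lambda>z. exp (- (A * z))) has_real_derivative - A * exp (- (A * z))) (at z)"
      by (auto intro!: derivative_eq_intros)
    show ?thesis
      \<comment> \<open>The \<open>z ^ i\<close> term from the product rule cancels the derivative
        of \<open>?G i z / A\<close>.\<close>
      by (rule DERIV_cong[OF DERIV_diff[OF DERIV_cdivide[OF Suc.IH, of A]
              DERIV_mult[OF exp DERIV_cdivide[OF power, of A]]]])
         (use assms in \<open>simp add: field_simps del: fact_Suc power_Suc\<close>)
  qed
  ultimately show ?case by simp
qed

text \<open>The exponential beats every power. With a zero limit at infinity, a tail integral is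
  minus the antiderivative at its lower end.\<close>

lemma tendsto_incomplete_gamma:
  fixes A :: real
  assumes "A > 0"
  shows "((\<lambda>z. - (exp (- (A * z)) * (\<Sum>l=0..i. z ^ l / fact l / A ^ (i - l + 1)))) \<longlongrightarrow> 0) at_top"
proof -
  have lim: "((\<lambda>z. exp (- (A * z)) * z ^ l) \<longlongrightarrow> 0) at_top" for l
  proof -
    have "((\<lambda>z. (A * z) ^ l / exp (A * z)) \<longlongrightarrow> 0) at_top"
      by (rule filterlim_compose[OF tendsto_power_div_exp_0])
         (rule filterlim_tendsto_pos_mult_at_top[OF tendsto_const assms filterlim_ident])
    then have "((\<lambda>z. (A * z) ^ l / exp (A * z) / A ^ l) \<longlongrightarrow> 0) at_top"
      by (rule tendsto_divide_zero)
    then show ?thesis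
      using assms by (simp add: power_mult_distrib exp_minus field_simps)
  qed
  have "((\<lambda>z. \<Sum>l=0..i. exp (- (A * z)) * z ^ l * (1 / fact l / A ^ (i - l + 1))) \<longlongrightarrow> 0) at_top"
    by (intro tendsto_null_sum tendsto_mult_left_zero lim)
  from tendsto_minus[OF this] show ?thesis
    by (simp add: sum_distrib_left)
qed

lemma shadowed_rician_ccdf:
  assumes m: "m \<ge> 1" and b: "b > 0" and Omega: "\<Omega> > 0"
    and Z: "shadowed_rician_power_gain M m b \<Omega> Z"
    and A1: "A1 = sr_beta b - sr_delta m b \<Omega>"
    and x: "x \<ge> 0"
  shows "measure M {\<omega> \<in> space M. x \<le> Z \<omega>} =
    (\<Sum>i=0..m-1. \<Sum>l=0..i. real ((m - 1) choose i) * (sr_alpha m b \<Omega> * sr_delta m b \<Omega> ^ i / fact l)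
       * exp (- (A1 * x)) * (x ^ l / A1 ^ (i - l + 1)))" (is "_ = ?T")
proof -
  obtain k where k: "m = Suc k" using m by (cases m) auto
  let ?\<alpha> = "sr_alpha m b \<Omega>" and ?\<delta> = "sr_delta m b \<Omega>"
  let ?G = "\<lambda>i z. - (exp (- (A1 * z)) * (\<Sum>l=0..i. z ^ l / fact l / A1 ^ (i - l + 1)))"
  define c where "c i = real (k choose i) * (?\<alpha> * ?\<delta> ^ i)" for i
  define f where "f z = (\<Sum>i=0..k. c i * (exp (- (A1 * z)) * (z ^ i / fact i)))" for z
  define F where "F z = (\<Sum>i=0..k. c i * ?G i z)" for z
  have pos: "0 < 2 * b * real m + \<Omega>" using b Omega by (simp add: add_nonneg_pos)
  have alpha0: "0 \<le> ?\<alpha>" and delta0: "0 \<le> ?\<delta>"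
    using b Omega pos by (simp_all add: sr_alpha_def sr_delta_def)
  \<comment> \<open>This closed form shows that \<open>A1\<close> is positive, which the decay at
    infinity requires.\<close>
  have "A1 = real m / (2 * b * real m + \<Omega>)"
  proof -
    have "A1 = 1 / (2 * b) * (1 - \<Omega> / (2 * b * real m + \<Omega>))"
      by (simp add: A1 sr_beta_def sr_delta_def algebra_simps)
    also have "1 - \<Omega> / (2 * b * real m + \<Omega>) = 2 * b * real m / (2 * b * real m + \<Omega>)"
      using pos by (simp add: diff_divide_eq_iff)
    finally show ?thesis using b by simp
  qed
  then have A1_pos: "0 < A1" using m pos by simp
  have c0: "0 \<le> c i" for i using alpha0 delta0 by (simp add: c_def)
  have density: "sr_density m b \<Omega> z = f z" if "0 \<le> z" for z
  proof -
    have "sr_density m b \<Omega> z =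
        ?\<alpha> * (exp (- sr_beta b * z) * exp (?\<delta> * z))
          * (\<Sum>i=0..k. real (k choose i) * ((?\<delta> * z) ^ i / fact i))"
      using that hypergeo_1F1_Suc[of k "?\<delta> * z"] by (simp add: sr_density_def k del: of_nat_Suc)
    also have "exp (- sr_beta b * z) * exp (?\<delta> * z) = exp (- (A1 * z))"
      by (simp add: A1 exp_add[symmetric] algebra_simps)
    finally show ?thesis
      by (simp add: f_def c_def sum_distrib_left power_mult_distrib algebra_simps)
  qed
  have "emeasure M {\<omega> \<in> space M. x \<le> Z \<omega>} = emeasure M (Z -` {x..} \<inter> space M)"
    by (rule arg_cong[of _ _ "emeasure M"]) auto
  also have "\<dots> = (\<integral>\<^sup>+z. ennreal (sr_density m b \<Omega> z) * indicator {x..} z \<partial>lborel)"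
    using Z by (intro distributed_emeasure) (auto simp: shadowed_rician_power_gain_def)
  \<comment> \<open>The density agrees with \<open>f\<close> on the nonnegative half-line, which
    contains the range of integration because \<open>x \<ge> 0\<close>.\<close>
  also have "\<dots> = (\<integral>\<^sup>+z. ennreal (f z) * indicator {x..} z \<partial>lborel)"
    using x by (intro nn_integral_cong) (auto simp: density indicator_def)
  also have "\<dots> = ennreal (0 - F x)"
  proof (rule nn_integral_FTC_atLeast)
    show "f \<in> borel_measurable borel" unfolding f_def by measurable
    show "DERIV F z :> f z" for z
      unfolding F_def f_def
      by (intro DERIV_sum DERIV_cmult DERIV_incomplete_gamma) (use A1_pos in simp)
    show "0 \<le> f z" if "x \<le> z" for z
      unfolding f_def using that x c0 by (intro sum_nonneg mult_nonneg_nonneg) auto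
    show "(F \<longlongrightarrow> 0) at_top"
      unfolding F_def
      by (intro tendsto_null_sum tendsto_mult_right_zero tendsto_incomplete_gamma A1_pos)
  qed
  also have "0 - F x = ?T"
    by (simp add: F_def c_def k sum_negf sum_distrib_left mult_ac)
  finally have "emeasure M {\<omega> \<in> space M. x \<le> Z \<omega>} = ennreal ?T" .
  \<comment> \<open>Since \<open>ennreal\<close> truncates negative numbers to 0, the sign is needed
    to return to a real-valued measure.\<close>
  moreover have "0 \<le> ?T"
    using x alpha0 delta0 A1_pos by (intro sum_nonneg mult_nonneg_nonneg) auto
  ultimately show ?thesis by (simp add: measure_def)
qed

text \<open>Clearing the positive denominator leaves \<open>t \<le> z * ?A\<close>, which fails for
  \<open>?A \<le> 0\<close> because \<open>t > 0\<close>. The conjunct \<open>0 < ?A\<close> is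
  essential: for \<open>?A \<le> 0\<close> the quotient \<open>t / ?A\<close> is at most 0 (it is 0
  when \<open>?A = 0\<close>), so the second conjunct alone would hold.\<close>

lemma sinr_ge_iff:
  fixes P L N0 q s t z :: real
  assumes "P > 0" "L > 0" "N0 > 0" "z \<ge> 0" "s \<ge> 0" "t > 0"
  shows "t \<le> P * q * z * L / (P * s * z * L + N0) \<longleftrightarrow>
    0 < P / N0 * L * (q - t * s) \<and> t / (P / N0 * L * (q - t * s)) \<le> z" (is "_ \<longleftrightarrow> 0 < ?A \<and> _")
proof -
  have "0 < P * s * z * L + N0" using assms by (simp add: add_nonneg_pos)
  then have "t \<le> P * q * z * L / (P * s * z * L + N0) \<longleftrightarrow> t * N0 \<le> z * (P * L * (q - t * s))"
    by (simp add: pos_le_divide_eq algebra_simps)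
  also have "P * L * (q - t * s) = ?A * N0" using assms by simp
  also have "t * N0 \<le> z * (?A * N0) \<longleftrightarrow> t \<le> z * ?A"
    using assms by (simp add: mult.assoc[symmetric] del: times_divide_eq_left times_divide_eq_right)
  also have "\<dots> \<longleftrightarrow> 0 < ?A \<and> t / ?A \<le> z"
  proof (cases "0 < ?A")
    case False
    then have "z * ?A \<le> 0" using mult_nonneg_nonpos[OF assms(4), of ?A] by (simp only: not_less)
    with False assms show ?thesis by linarith
  qed (simp only: pos_divide_le_eq simp_thms)
  finally show ?thesis .
qed

theorem proposition1:
  fixes M :: "'a measure"
    and Z :: "'a \<Rightarrow> real"
    and m N n :: nat
    and b \<Omega> \<alpha> \<beta> \<delta> P L N0 \<rho> \<zeta>c R_c R_p \<gamma>c_th \<gamma>p_th A1 A2 A3 P_out P_c P_p :: real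
    and \<zeta> :: "nat \<Rightarrow> real"
    and \<gamma>c \<gamma>p :: "'a \<Rightarrow> real"
  assumes "prob_space M"
    and n: "n \<in> {1..N}"
    and m: "m \<ge> 1" and b: "b > 0" and Omega: "\<Omega> > 0"
    and Z: "shadowed_rician_power_gain M m b \<Omega> Z"
    and alpha: "\<alpha> = sr_alpha m b \<Omega>"
    and beta: "\<beta> = sr_beta b"
    and delta: "\<delta> = sr_delta m b \<Omega>"
    and P: "P > 0" and L: "L > 0" and N0: "N0 > 0"
    and rho: "\<rho> = P / N0"
    and zeta_c_nonneg: "\<zeta>c \<ge> 0"
    and zeta_nonneg: "\<And>j. j \<in> {1..N} \<Longrightarrow> \<zeta> j \<ge> 0"
    and zeta_sum: "\<zeta>c + (\<Sum>j\<in>{1..N}. \<zeta> j) = 1"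
    and R_c: "R_c > 0" and R_p: "R_p > 0"
    and gamma_c_th: "\<gamma>c_th = 2 powr R_c - 1"
    and gamma_p_th: "\<gamma>p_th = 2 powr R_p - 1"
    and gamma_c: "\<And>\<omega>. \<gamma>c \<omega> = P * \<zeta>c * Z \<omega> * L / (P * (1 - \<zeta>c) * Z \<omega> * L + N0)"
    and gamma_p: "\<And>\<omega>. \<gamma>p \<omega> =
          P * \<zeta> n * Z \<omega> * L / ((\<Sum>j\<in>{1..N} - {n}. \<zeta> j * P * Z \<omega> * L) + N0)"
    and P_out: "P_out = 1 - measure M {\<omega> \<in> space M. \<gamma>c \<omega> \<ge> \<gamma>c_th \<and> \<gamma>p \<omega> \<ge> \<gamma>p_th}"
    and A1: "A1 = \<beta> - \<delta>"
    and A2: "A2 = \<rho> * L * (\<zeta>c - \<gamma>c_th * (1 - \<zeta>c))"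
    and A3: "A3 = \<rho> * L * (\<zeta> n - \<gamma>p_th * (\<Sum>j\<in>{1..N} - {n}. \<zeta> j))"
    and P_c: "P_c = (if A2 > 0
          then 1 - (\<Sum>i=0..m-1. \<Sum>l=0..i.
                      real ((m - 1) choose i) * (\<alpha> * \<delta> ^ i / fact l)
                        * exp (- (A1 * \<gamma>c_th / A2)) * ((\<gamma>c_th / A2) ^ l / A1 ^ (i - l + 1)))
          else 1)"
    and P_p: "P_p = (if A3 > 0
          then 1 - (\<Sum>i=0..m-1. \<Sum>l=0..i.
                      real ((m - 1) choose i) * (\<alpha> * \<delta> ^ i / fact l)
                        * exp (- (A1 * \<gamma>p_th / A3)) * ((\<gamma>p_th / A3) ^ l / A1 ^ (i - l + 1)))
          else 1)"
  shows "P_out = max P_c P_p"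
proof -
  interpret prob_space M by fact
  define s where "s = (\<Sum>j\<in>{1..N} - {n}. \<zeta> j)"
  define T where "T x = measure M {\<omega> \<in> space M. x \<le> Z \<omega>}" for x
  have [measurable]: "Z \<in> borel_measurable M" and Z0: "AE \<omega> in M. 0 \<le> Z \<omega>"
    using Z distributed_measurable[of M lborel Z] by (auto simp: shadowed_rician_power_gain_def)
  have c: "\<gamma>c_th > 0" and p: "\<gamma>p_th > 0"
    using R_c R_p by (simp_all add: gamma_c_th gamma_p_th)
  have s0: "0 \<le> s" unfolding s_def using zeta_nonneg by (intro sum_nonneg) auto
  have "0 \<le> (\<Sum>j\<in>{1..N}. \<zeta> j)" using zeta_nonneg by (intro sum_nonneg) auto
  then have zc: "0 \<le> 1 - \<zeta>c" using zeta_sum by linarith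
  have iff_c: "\<gamma>c_th \<le> \<gamma>c \<omega> \<longleftrightarrow> 0 < A2 \<and> \<gamma>c_th / A2 \<le> Z \<omega>" if "0 \<le> Z \<omega>" for \<omega>
    unfolding gamma_c A2 rho by (rule sinr_ge_iff[OF P L N0 that zc c])
  \<comment> \<open>Factoring the gain out of the interference sum gives both SINRs the shape
    treated by \<open>sinr_ge_iff\<close>, with interference share \<open>1 - \<zeta>c\<close> or
    \<open>s\<close>.\<close>
  have gamma_p': "\<gamma>p \<omega> = P * \<zeta> n * Z \<omega> * L / (P * s * Z \<omega> * L + N0)" for \<omega>
    by (simp add: gamma_p s_def sum_distrib_left sum_distrib_right mult_ac)
  have iff_p: "\<gamma>p_th \<le> \<gamma>p \<omega> \<longleftrightarrow> 0 < A3 \<and> \<gamma>p_th / A3 \<le> Z \<omega>" if "0 \<le> Z \<omega>" for \<omega>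
    unfolding gamma_p' A3 rho s_def[symmetric] by (rule sinr_ge_iff[OF P L N0 that s0 p])
  have [measurable]: "\<gamma>c \<in> borel_measurable M"
  proof -
    have "\<gamma>c = (\<lambda>\<omega>. P * \<zeta>c * Z \<omega> * L / (P * (1 - \<zeta>c) * Z \<omega> * L + N0))"
      using gamma_c by auto
    then show ?thesis by simp
  qed
  have [measurable]: "\<gamma>p \<in> borel_measurable M"
  proof -
    have "\<gamma>p = (\<lambda>\<omega>. P * \<zeta> n * Z \<omega> * L / (P * s * Z \<omega> * L + N0))"
      using gamma_p' by auto
    then show ?thesis by simp
  qed
  \<comment> \<open>The gain is nonnegative only almost surely, so the two events are equal up to a
    null set; comparing their probabilities uses the measurability of the SINRs.\<close>
  have P_out': "P_out = 1 - prob {\<omega> \<in> space M.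
      (0 < A2 \<and> \<gamma>c_th / A2 \<le> Z \<omega>) \<and> (0 < A3 \<and> \<gamma>p_th / A3 \<le> Z \<omega>)}"
  proof -
    have "AE \<omega> in M. (\<gamma>c_th \<le> \<gamma>c \<omega> \<and> \<gamma>p_th \<le> \<gamma>p \<omega>) =
        ((0 < A2 \<and> \<gamma>c_th / A2 \<le> Z \<omega>) \<and> (0 < A3 \<and> \<gamma>p_th / A3 \<le> Z \<omega>))"
      using Z0 by eventually_elim (simp add: iff_c iff_p)
    then show ?thesis unfolding P_out by (subst prob_eq_AE) auto
  qed
  have T_anti: "T y \<le> T x" if "x \<le> y" for x y
    unfolding T_def using that by (intro finite_measure_mono) auto
  have T0: "0 \<le> T x" for x by (simp add: T_def)
  \<comment> \<open>The two tail events are nested, so their intersection is the one with the larger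
    level, which has the smaller probability.\<close>
  have both: "prob {\<omega> \<in> space M. x \<le> Z \<omega> \<and> y \<le> Z \<omega>} = min (T x) (T y)" for x y
  proof -
    have "prob {\<omega> \<in> space M. x \<le> Z \<omega> \<and> y \<le> Z \<omega>} = T (max x y)"
      by (simp add: T_def)
    also have "\<dots> = min (T x) (T y)"
      using T_anti[of x y] T_anti[of y x] by (cases "x \<le> y") (auto simp: max_def min_def)
    finally show ?thesis .
  qed
  have ccdf: "T x = (\<Sum>i=0..m-1. \<Sum>l=0..i. real ((m - 1) choose i) * (\<alpha> * \<delta> ^ i / fact l)
       * exp (- (A1 * x)) * (x ^ l / A1 ^ (i - l + 1)))" if "0 \<le> x" for x
    unfolding T_def alpha delta
    by (rule shadowed_rician_ccdf[OF m b Omega Z _ that]) (simp add: A1 beta delta)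
  have Pc: "P_c = (if 0 < A2 then 1 - T (\<gamma>c_th / A2) else 1)"
    unfolding P_c using c by (simp add: ccdf)
  have Pp: "P_p = (if 0 < A3 then 1 - T (\<gamma>p_th / A3) else 1)"
    unfolding P_p using p by (simp add: ccdf)
  \<comment> \<open>If \<open>A2\<close> and \<open>A3\<close> are positive, this is
    \<open>1 - min a b = max (1 - a) (1 - b)\<close>. Otherwise the success event is empty, and
    \<open>T0\<close> ensures that the other term of the maximum does not exceed 1.\<close>
  show ?thesis
    unfolding P_out' Pc Pp
    using T0[of "\<gamma>c_th / A2"] T0[of "\<gamma>p_th / A3"] by (auto simp: both min_def max_def)
qed

end
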